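(* For Muchnik degrees $\mathbf{A}$ and $\mathbf{B}$ with $\mathbf{A}<_w\mathbf{B}$, the interval $(\mathbf{A},\mathbf{B})=\{\mathbf{X}:\mathbf{A}<_w\mathbf{X}<_w\mathbf{B}\}$ is empty if and only if there is a degree of solvability $\mathbf{S}$ such that $\mathbf{A}\equiv_w\mathbf{B}\times\mathbf{S}$, $\mathbf{B}\not\le_w\mathbf{S}$, and $\mathbf{B}\le_w\mathbf{S}'$.
   Context: Mass problems are subsets of Baire space $\omega^\omega$. For mass problems $\mathcal{A},\mathcal{B}$, $\mathcal{A}\le_w\mathcal{B}$ iff for every $f\in\mathcal{B}$ there is $g\in\mathcal{A}$ with $g\le_T f$; $\equiv_w$ is the induced equivalence and Muchnik degrees are its classes, ordered by $\le_w$. The meet $\mathbf{B}\times\mathbf{S}$ is the degree of $\{0^\frown f: f\in\mathcal{B}\}\cup\{1^\frown g:g\in\mathcal{S}\}$ for representatives $\mathcal{B},\mathcal{S}$. A degree of solvability is a Muchnik degree containing a singleton $\{f\}$; for $\mathbf{S}=\deg_w(\{f\})$, $\mathbf{S}'$ denotes the Muchnik degree of $\{g\in\omega^\omega: f<_T g\}$. *)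

theory Defs
  imports Main
begin

text \<open>
  Turing reducibility is presented through the partial recursive functionals: programs are the
  Kleene schemes for partial recursive functions on tuples, with an extra basic function for the
  oracle. The relation \<open>eval g p xs y\<close> says that \<open>p\<close> with oracle \<open>g\<close> halts on \<open>xs\<close> with output \<open>y\<close>.
\<close>

datatype prog =
    Zero
  | Succ
  | Proj nat
  | Oracle
  | Comp prog "prog list"
  | PrimRec prog prog
  | Mu prog

inductive eval :: "(nat \<Rightarrow> nat) \<Rightarrow> prog \<Rightarrow> nat list \<Rightarrow> nat \<Rightarrow> bool" for g where
  eval_Zero: "eval g Zero xs 0"
| eval_Succ: "eval g Succ [x] (Suc x)"
| eval_Proj: "i < length xs \<Longrightarrow> eval g (Proj i) xs (xs ! i)"
| eval_Oracle: "eval g Oracle [x] (g x)"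
| eval_Comp: "\<lbrakk>length ys = length ps; \<forall>i<length ps. eval g (ps ! i) xs (ys ! i); eval g q ys z\<rbrakk>
    \<Longrightarrow> eval g (Comp q ps) xs z"
| eval_PrimRec_0: "eval g p xs y \<Longrightarrow> eval g (PrimRec p q) (0 # xs) y"
| eval_PrimRec_Suc: "\<lbrakk>eval g (PrimRec p q) (n # xs) r; eval g q (r # n # xs) y\<rbrakk>
    \<Longrightarrow> eval g (PrimRec p q) (Suc n # xs) y"
| eval_Mu: "\<lbrakk>eval g p (n # xs) 0; \<forall>m<n. \<exists>k. eval g p (m # xs) (Suc k)\<rbrakk>
    \<Longrightarrow> eval g (Mu p) xs n"

inductive_cases eval_ZeroE: "eval g Zero xs y"
inductive_cases eval_SuccE: "eval g Succ xs y"
inductive_cases eval_ProjE: "eval g (Proj i) xs y"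
inductive_cases eval_OracleE: "eval g Oracle xs y"
inductive_cases eval_CompE: "eval g (Comp q ps) xs y"
inductive_cases eval_PrimRec_0E: "eval g (PrimRec p q) (0 # xs) y"
inductive_cases eval_PrimRec_SucE: "eval g (PrimRec p q) (Suc n # xs) y"
inductive_cases eval_MuE: "eval g (Mu p) xs y"

lemma eval_deterministic: "eval g p xs y \<Longrightarrow> eval g p xs z \<Longrightarrow> y = z"
proof (induction arbitrary: z rule: eval.induct)
  case (eval_Comp ys ps xs q y)
  from eval_Comp.prems obtain ys' where ys': "length ys' = length ps"
    "\<forall>i<length ps. eval g (ps ! i) xs (ys' ! i)" "eval g q ys' z"
    by (auto elim: eval_CompE)
  have "ys = ys'"
    using eval_Comp.hyps eval_Comp.IH ys' by (auto intro!: nth_equalityI)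
  with eval_Comp.IH ys' show ?case by blast
next
  case (eval_PrimRec_Suc p q n xs r y)
  from eval_PrimRec_Suc.prems obtain r' where
    "eval g (PrimRec p q) (n # xs) r'" "eval g q (r' # n # xs) z"
    by (auto elim: eval_PrimRec_SucE)
  with eval_PrimRec_Suc.IH show ?case by blast
next
  case (eval_Mu p n xs)
  from eval_Mu.prems have z: "eval g p (z # xs) 0" "\<forall>m<z. \<exists>k. eval g p (m # xs) (Suc k)"
    by (auto elim: eval_MuE)
  have "\<not> n < z" using eval_Mu.IH z by (metis nat.distinct(1))
  moreover have "\<not> z < n" using eval_Mu.IH z by (metis nat.distinct(1))
  ultimately show ?case by simp
qed (blast elim: eval_ZeroE eval_SuccE eval_ProjE eval_OracleE eval_PrimRec_0E)+

definition turing_le :: "(nat \<Rightarrow> nat) \<Rightarrow> (nat \<Rightarrow> nat) \<Rightarrow> bool" (infix "\<le>\<^sub>T" 50) where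
  "f \<le>\<^sub>T g \<longleftrightarrow> (\<exists>p. \<forall>n y. eval g p [n] y \<longleftrightarrow> y = f n)"

definition turing_less :: "(nat \<Rightarrow> nat) \<Rightarrow> (nat \<Rightarrow> nat) \<Rightarrow> bool" (infix "<\<^sub>T" 50) where
  "f <\<^sub>T g \<longleftrightarrow> f \<le>\<^sub>T g \<and> \<not> g \<le>\<^sub>T f"

lemma turing_leI: "(\<And>n. eval g p [n] (f n)) \<Longrightarrow> f \<le>\<^sub>T g"
  unfolding turing_le_def using eval_deterministic by blast

lemma turing_le_refl: "f \<le>\<^sub>T f"
  by (rule turing_leI[where p = Oracle]) (rule eval_Oracle)

primrec subst_oracle :: "prog \<Rightarrow> prog \<Rightarrow> prog" where
  "subst_oracle s Zero = Zero"
| "subst_oracle s Succ = Succ"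
| "subst_oracle s (Proj i) = Proj i"
| "subst_oracle s Oracle = s"
| "subst_oracle s (Comp q ps) = Comp (subst_oracle s q) (map (subst_oracle s) ps)"
| "subst_oracle s (PrimRec p q) = PrimRec (subst_oracle s p) (subst_oracle s q)"
| "subst_oracle s (Mu p) = Mu (subst_oracle s p)"

lemma eval_subst_oracle:
  assumes "eval g p xs y" and s: "\<And>n. eval h s [n] (g n)"
  shows "eval h (subst_oracle s p) xs y"
  using assms(1)
proof (induction rule: eval.induct)
  case (eval_Comp ys ps xs q z)
  then show ?case by (auto intro!: eval.eval_Comp[of ys])
next
  case (eval_Mu p n xs)
  then show ?case by (auto intro!: eval.eval_Mu)
qed (simp_all add: s eval.intros eval_PrimRec_Suc[rotated])

lemma turing_le_trans: "f \<le>\<^sub>T g \<Longrightarrow> g \<le>\<^sub>T h \<Longrightarrow> f \<le>\<^sub>T h"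
proof -
  assume "f \<le>\<^sub>T g" "g \<le>\<^sub>T h"
  then obtain p s where "\<And>n. eval g p [n] (f n)" "\<And>n. eval h s [n] (g n)"
    unfolding turing_le_def by blast
  then show ?thesis
    by (intro turing_leI[where p = "subst_oracle s p"] eval_subst_oracle)
qed

text \<open>The sequence \<open>case_nat i f\<close> is the concatenation \<open>i\<^sup>\<frown>f\<close>.\<close>

lemma turing_le_case_nat: "f \<le>\<^sub>T case_nat i f"
proof (rule turing_leI)
  fix n
  show "eval (case_nat i f) (Comp Oracle [Succ]) [n] (f n)"
    using eval_Comp[of "[Suc n]" "[Succ]" "case_nat i f" "[n]" Oracle "f n"]
      eval_Oracle[of "case_nat i f" "Suc n"]
    by (auto intro: eval_Succ)
qed

lemma case_nat_turing_le: "case_nat i f \<le>\<^sub>T f"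
proof -
  have "\<exists>c. eval f c [] i"
  proof (induction i)
    case 0
    show ?case by (blast intro: eval_Zero)
  next
    case (Suc i)
    then obtain c where "eval f c [] i" ..
    then have "eval f (Comp Succ [c]) [] (Suc i)"
      using eval_Comp[of "[i]" "[c]" f "[]" Succ "Suc i"] by (auto intro: eval_Succ)
    then show ?case ..
  qed
  then obtain c where c: "eval f c [] i" ..
  have step: "eval f (Comp Oracle [Proj 1]) (r # n # []) (f n)" for r n
    using eval_Comp[of "[n]" "[Proj 1]" f "[r, n]" Oracle "f n"] eval_Proj[of 1 "[r, n]" f]
    by (auto intro: eval_Oracle)
  have "eval f (PrimRec c (Comp Oracle [Proj 1])) [n] (case_nat i f n)" for n
  proof (induction n)
    case 0
    show ?case using c by (auto intro: eval_PrimRec_0)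
  next
    case (Suc n)
    then show ?case using step by (auto intro: eval_PrimRec_Suc)
  qed
  then show ?thesis by (rule turing_leI)
qed

definition weak_le :: "(nat \<Rightarrow> nat) set \<Rightarrow> (nat \<Rightarrow> nat) set \<Rightarrow> bool" (infix "\<le>\<^sub>w" 50) where
  "A \<le>\<^sub>w B \<longleftrightarrow> (\<forall>f\<in>B. \<exists>g\<in>A. g \<le>\<^sub>T f)"

definition weak_equiv :: "(nat \<Rightarrow> nat) set \<Rightarrow> (nat \<Rightarrow> nat) set \<Rightarrow> bool" (infix "\<equiv>\<^sub>w" 50) where
  "A \<equiv>\<^sub>w B \<longleftrightarrow> A \<le>\<^sub>w B \<and> B \<le>\<^sub>w A"

lemma weak_le_refl: "A \<le>\<^sub>w A"
  unfolding weak_le_def using turing_le_refl by blast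

lemma weak_le_trans: "A \<le>\<^sub>w B \<Longrightarrow> B \<le>\<^sub>w C \<Longrightarrow> A \<le>\<^sub>w C"
  unfolding weak_le_def by (meson turing_le_trans)

definition mass_meet :: "(nat \<Rightarrow> nat) set \<Rightarrow> (nat \<Rightarrow> nat) set \<Rightarrow> (nat \<Rightarrow> nat) set" where
  "mass_meet A B = case_nat 0 ` A \<union> case_nat 1 ` B"

lemma mass_meet_le1: "mass_meet A B \<le>\<^sub>w A"
  unfolding weak_le_def mass_meet_def using case_nat_turing_le by blast

lemma mass_meet_le2: "mass_meet A B \<le>\<^sub>w B"
  unfolding weak_le_def mass_meet_def using case_nat_turing_le by blast

lemma mass_meet_greatest: "C \<le>\<^sub>w A \<Longrightarrow> C \<le>\<^sub>w B \<Longrightarrow> C \<le>\<^sub>w mass_meet A B"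
  unfolding weak_le_def mass_meet_def
  by (simp add: ball_Un) (meson turing_le_case_nat turing_le_trans)

quotient_type muchnik = "(nat \<Rightarrow> nat) set" / weak_equiv
  morphisms rep_muchnik deg\<^sub>w
proof (rule equivpI)
  show "reflp weak_equiv" by (simp add: reflp_def weak_equiv_def weak_le_refl)
  show "symp weak_equiv" by (simp add: symp_def weak_equiv_def)
  show "transp weak_equiv" unfolding transp_def weak_equiv_def by (meson weak_le_trans)
qed

instantiation muchnik :: semilattice_inf
begin

lift_definition less_eq_muchnik :: "muchnik \<Rightarrow> muchnik \<Rightarrow> bool" is weak_le
  unfolding weak_equiv_def by (meson weak_le_trans)

definition less_muchnik :: "muchnik \<Rightarrow> muchnik \<Rightarrow> bool" where
  "less_muchnik A B \<longleftrightarrow> A \<le> B \<and> \<not> B \<le> A"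

lift_definition inf_muchnik :: "muchnik \<Rightarrow> muchnik \<Rightarrow> muchnik" is mass_meet
  unfolding weak_equiv_def
  by (meson mass_meet_greatest mass_meet_le1 mass_meet_le2 weak_le_trans)

instance
proof
  fix A B C :: muchnik
  show "A < B \<longleftrightarrow> A \<le> B \<and> \<not> B \<le> A" by (rule less_muchnik_def)
  show "A \<le> A" by transfer (rule weak_le_refl)
  show "A \<le> B \<Longrightarrow> B \<le> C \<Longrightarrow> A \<le> C" by transfer (rule weak_le_trans)
  show "A \<le> B \<Longrightarrow> B \<le> A \<Longrightarrow> A = B" by transfer (simp add: weak_equiv_def)
  show "inf A B \<le> A" by transfer (rule mass_meet_le1)
  show "inf A B \<le> B" by transfer (rule mass_meet_le2)
  show "A \<le> B \<Longrightarrow> A \<le> C \<Longrightarrow> A \<le> inf B C" by transfer (rule mass_meet_greatest)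
qed

end

definition degree_of_solvability :: "muchnik \<Rightarrow> bool" where
  "degree_of_solvability S \<longleftrightarrow> (\<exists>f. S = deg\<^sub>w {f})"

text \<open>
  The degree \<open>S'\<close>, meaningful only if \<open>S\<close> is a degree of solvability; the lemma
  \<open>solv_prime_deg\<close> shows independence of the chosen representative.
\<close>

definition solv_prime :: "muchnik \<Rightarrow> muchnik" where
  "solv_prime S = deg\<^sub>w {g. (SOME f. S = deg\<^sub>w {f}) <\<^sub>T g}"

lemma deg_singleton_eq_iff: "deg\<^sub>w {f} = deg\<^sub>w {h} \<longleftrightarrow> f \<le>\<^sub>T h \<and> h \<le>\<^sub>T f"
  by (auto simp: muchnik.abs_eq_iff weak_equiv_def weak_le_def)

lemma solv_prime_deg: "solv_prime (deg\<^sub>w {f}) = deg\<^sub>w {g. f <\<^sub>T g}"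
proof -
  define h where "h = (SOME h. deg\<^sub>w {f} = deg\<^sub>w {h})"
  have "deg\<^sub>w {f} = deg\<^sub>w {h}" unfolding h_def by (rule someI[of _ f]) (rule refl)
  then have "f \<le>\<^sub>T h" "h \<le>\<^sub>T f" by (simp_all add: deg_singleton_eq_iff)
  then have "{g. h <\<^sub>T g} = {g. f <\<^sub>T g}"
    unfolding turing_less_def by (meson turing_le_trans)
  then show ?thesis unfolding solv_prime_def h_def by simp
qed

end

theory Submission
  imports Defs
begin

text \<open>
  Identify a Muchnik degree with its largest representative, an upward closed set of functions,
  and pick \<open>f \<in> A - B\<close>. The upward closed sets \<open>B \<union> {g. f \<le>\<^sub>T g}\<close> and
  \<open>B \<union> {g. f <\<^sub>T g}\<close> lie between \<open>B\<close> and \<open>A\<close>; the first contains \<open>f\<close> and the second does not.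
  Hence, if the interval is empty, the first is \<open>A\<close> and the second is \<open>B\<close>. Conversely,
  under the stated condition \<open>A\<close> exceeds \<open>B\<close> only by the Turing degree of \<open>f\<close>, so
  nothing fits in between.
\<close>

lemma muchnik_degE:
  obtains a where "X = deg\<^sub>w a"
  by (metis Quotient_abs_rep[OF Quotient_muchnik])

lemma deg_le_iff: "deg\<^sub>w A \<le> deg\<^sub>w B \<longleftrightarrow> A \<le>\<^sub>w B"
  by (rule less_eq_muchnik.abs_eq)

lemma deg_le_singleton_iff: "deg\<^sub>w A \<le> deg\<^sub>w {f} \<longleftrightarrow> (\<exists>g\<in>A. g \<le>\<^sub>T f)"
  by (simp add: deg_le_iff weak_le_def)

lemma deg_le_iff_singletons: "A \<le> deg\<^sub>w B \<longleftrightarrow> (\<forall>f\<in>B. A \<le> deg\<^sub>w {f})"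
  by (cases A rule: muchnik_degE) (simp add: deg_le_iff weak_le_def)

text \<open>The \<open>f\<close> with \<open>B \<le> deg\<^sub>w {f}\<close> form the largest
  representative of \<open>B\<close>, so the order is reverse inclusion of these sets.\<close>

lemma muchnik_le_iff_singletons:
  fixes A B :: muchnik
  shows "A \<le> B \<longleftrightarrow> (\<forall>f. B \<le> deg\<^sub>w {f} \<longrightarrow> A \<le> deg\<^sub>w {f})"
proof
  assume below: "\<forall>f. B \<le> deg\<^sub>w {f} \<longrightarrow> A \<le> deg\<^sub>w {f}"
  obtain b where B: "B = deg\<^sub>w b" by (rule muchnik_degE)
  show "A \<le> B"
    using below turing_le_refl unfolding B deg_le_iff_singletons[of A b] deg_le_singleton_iff by blast
qed (meson order_trans)

text \<open>Each element of \<open>mass_meet a b\<close> computes its tail, which lies in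
  \<open>a\<close> or \<open>b\<close>; so meets become unions.\<close>

lemma inf_le_singleton_iff:
  "inf A B \<le> deg\<^sub>w {f} \<longleftrightarrow> A \<le> deg\<^sub>w {f} \<or> B \<le> deg\<^sub>w {f}"
proof
  assume le: "inf A B \<le> deg\<^sub>w {f}"
  obtain a b where ab: "A = deg\<^sub>w a" "B = deg\<^sub>w b" by (metis muchnik_degE)
  have "\<exists>g\<in>mass_meet a b. g \<le>\<^sub>T f"
    using le by (simp add: ab inf_muchnik.abs_eq deg_le_singleton_iff)
  then show "A \<le> deg\<^sub>w {f} \<or> B \<le> deg\<^sub>w {f}"
    unfolding ab deg_le_singleton_iff mass_meet_def
    by (auto intro: turing_le_trans[OF turing_le_case_nat])
qed (meson inf_le1 inf_le2 order_trans)

text \<open>The functions strictly above \<open>f\<close> already form an upward closed set.\<close>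

lemma solv_prime_le_singleton_iff:
  "solv_prime (deg\<^sub>w {f}) \<le> deg\<^sub>w {g} \<longleftrightarrow> f <\<^sub>T g"
  unfolding solv_prime_deg deg_le_singleton_iff turing_less_def mem_Collect_eq bex_simps
  by (meson turing_le_trans turing_le_refl)

theorem theorem1p3:
  fixes A B :: muchnik
  assumes "A < B"
  shows "{X. A < X \<and> X < B} = {} \<longleftrightarrow>
    (\<exists>S. degree_of_solvability S \<and> A = inf B S \<and> \<not> B \<le> S \<and> B \<le> solv_prime S)"
proof
  assume "{X. A < X \<and> X < B} = {}"
  then have gap: "X = A \<or> X = B" if "A \<le> X" "X \<le> B" for X
    using that by (auto simp: order.order_iff_strict)
  obtain f where f: "A \<le> deg\<^sub>w {f}" "\<not> B \<le> deg\<^sub>w {f}"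
    using assms muchnik_le_iff_singletons[of B A] by (auto simp: less_le_not_le)
  let ?S = "deg\<^sub>w {f}"
  have "?S \<le> solv_prime ?S"
    by (auto simp: muchnik_le_iff_singletons[of ?S] solv_prime_le_singleton_iff
        deg_le_singleton_iff turing_less_def)
  then have "A \<le> inf B (solv_prime ?S)"
    using assms f by auto
  moreover have "\<not> inf B (solv_prime ?S) \<le> ?S"
    using f by (simp add: inf_le_singleton_iff solv_prime_le_singleton_iff turing_less_def)
  \<comment> \<open>\<open>gap\<close> leaves only \<open>A\<close> and \<open>B\<close>;
    \<open>A\<close> is excluded because it lies below \<open>?S\<close>.\<close>
  ultimately have "inf B (solv_prime ?S) = B"
    using gap[of "inf B (solv_prime ?S)"] f by auto
  then have "B \<le> solv_prime ?S" by (simp add: le_iff_inf)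
  \<comment> \<open>The meet lies below \<open>?S\<close> and \<open>B\<close> does not, so
    \<open>gap\<close> makes it \<open>A\<close>.\<close>
  moreover have "A = inf B ?S"
    using gap[of "inf B ?S"] assms f by (metis inf.cobounded1 inf.cobounded2 le_infI less_imp_le)
  ultimately show "\<exists>S. degree_of_solvability S \<and> A = inf B S \<and> \<not> B \<le> S \<and> B \<le> solv_prime S"
    using f unfolding degree_of_solvability_def by blast
next
  assume "\<exists>S. degree_of_solvability S \<and> A = inf B S \<and> \<not> B \<le> S \<and> B \<le> solv_prime S"
  then obtain f where A: "A = inf B (deg\<^sub>w {f})" and B: "B \<le> solv_prime (deg\<^sub>w {f})"
    unfolding degree_of_solvability_def by blast
  have False if X: "A < X" "X < B" for X
  proof -
    \<comment> \<open>A witness for \<open>X\<close> exceeding \<open>B\<close>; it turns out Turing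
      equivalent to \<open>f\<close>.\<close>
    obtain h where h: "X \<le> deg\<^sub>w {h}" "\<not> B \<le> deg\<^sub>w {h}"
      using X(2) muchnik_le_iff_singletons[of B X] by (auto simp: less_le_not_le)
    have "inf B (deg\<^sub>w {f}) \<le> deg\<^sub>w {h}" using X(1) h(1) A by auto
    then have "f \<le>\<^sub>T h" using h(2) by (simp add: inf_le_singleton_iff deg_le_singleton_iff)
    moreover have "\<not> f <\<^sub>T h"
      using B h(2) solv_prime_le_singleton_iff by (meson order_trans)
    ultimately have "deg\<^sub>w {h} = deg\<^sub>w {f}"
      by (simp add: deg_singleton_eq_iff turing_less_def)
    \<comment> \<open>Now \<open>X\<close> lies below both \<open>B\<close> and
      \<open>deg\<^sub>w {f}\<close>, hence below their meet.\<close>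
    then have "X \<le> A" using h(1) X(2) A by auto
    then show False using X(1) by auto
  qed
  then show "{X. A < X \<and> X < B} = {}" by blast
qed

end
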